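(* Let $\tau$ be the shipment-release time of a renewal-type clearing policy, i.e. a stopping time with respect to the natural filtration of $N$ with $0<\mathbb{E}[\tau]<\infty$. Then $$\mathbb{E}[W(\tau)]=\frac{1}{2\lambda}\mathbb{E}[N^2(\tau)-N(\tau)],\qquad \mathbb{E}[\tau]=\frac1\lambda\mathbb{E}[N(\tau)],$$ and hence the average order delay of the policy is $$AOD_\tau=\frac{\mathbb{E}[N^2(\tau)-N(\tau)]/(2\lambda)}{\mathbb{E}[N(\tau)]}.$$
   Context: Customer orders arrive according to a Poisson process $\{N(t)\}_{t\ge 0}$ with rate $\lambda>0$ and $N(0)=0$, with natural filtration $\mathcal{G}_t=\sigma(N(s):s\in[0,t])$. For a policy with release time $\tau$ (the length of one consolidation cycle started at time $0$), the cumulative waiting time in a cycle is $W(\tau)=\int_0^\tau N(u)\,du$, and the average order delay is $AOD_\tau=\mathbb{E}[W(\tau)]/(\lambda\,\mathbb{E}[\tau])$. The quantities $\mathbb{E}[W(\tau)]$, $\mathbb{E}[N^2(\tau)-N(\tau)]$ and $AOD_\tau$ take values in $[0,\infty]$. *)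

theory Defs
  imports "HOL-Probability.Probability"
begin

text \<open>Times at which the process is observed are nonnegative reals; values of \<open>N\<close> at negative
  arguments are irrelevant. Paths are required to be nondecreasing and right-continuous at every
  point of the sample space (not only almost surely), so that \<open>W(\<tau>)\<close> and \<open>N(\<tau>)\<close> are measurable
  without completing the filtration. The truncated subtraction in the increments is harmless because
  paths are nondecreasing.\<close>

locale poisson_process = prob_space M
  for M :: "'a measure" and N :: "real \<Rightarrow> 'a \<Rightarrow> nat" and rate :: real +
  assumes rate_pos: "0 < rate"
    and measurable_N: "0 \<le> t \<Longrightarrow> N t \<in> measurable M (count_space UNIV)"
    and N_zero: "\<omega> \<in> space M \<Longrightarrow> N 0 \<omega> = 0"
    and mono_path: "\<omega> \<in> space M \<Longrightarrow> 0 \<le> s \<Longrightarrow> s \<le> t \<Longrightarrow> N s \<omega> \<le> N t \<omega>"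
    and right_continuous_path:
      "\<omega> \<in> space M \<Longrightarrow> 0 \<le> t \<Longrightarrow> continuous (at_right t) (\<lambda>u. N u \<omega>)"
    and poisson_increments:
      "0 \<le> s \<Longrightarrow> s < t \<Longrightarrow>
        distr M (count_space UNIV) (\<lambda>\<omega>. N t \<omega> - N s \<omega>) = measure_pmf (poisson_pmf (rate * (t - s)))"
    and independent_increments:
      "0 \<le> p 0 \<Longrightarrow> (\<And>i. i < n \<Longrightarrow> p i < p (Suc i)) \<Longrightarrow>
        indep_vars (\<lambda>_. count_space UNIV) (\<lambda>i \<omega>. N (p (Suc i)) \<omega> - N (p i) \<omega>) {..<n::nat}"

text \<open>The filtration is indexed by \<^typ>\<open>ennreal\<close> so that the library's \<^const>\<open>stopping_time\<close> covers
  exactly the stopping times with values in \<open>[0,\<infinity>]\<close>; at a finite index \<open>t\<close> it is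
  \<open>\<sigma>(N(s) : s \<in> [0,t])\<close>.\<close>

definition natural_filtration ::
    "'a measure \<Rightarrow> (real \<Rightarrow> 'a \<Rightarrow> nat) \<Rightarrow> ennreal \<Rightarrow> 'a measure" where
  "natural_filtration M N t =
    sigma (space M) {N s -` A \<inter> space M | s A. 0 \<le> s \<and> ennreal s \<le> t}"

lemma filtration_natural_filtration: "filtration (space M) (natural_filtration M N)"
proof
  show "space (natural_filtration M N t) = space M" for t
    unfolding natural_filtration_def by (rule space_measure_of) auto
next
  fix t u :: ennreal
  assume "t \<le> u"
  then have "{N s -` A \<inter> space M | s A. 0 \<le> s \<and> ennreal s \<le> t}
      \<subseteq> {N s -` A \<inter> space M | s A. 0 \<le> s \<and> ennreal s \<le> u}"
    by (auto intro: order_trans)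
  then show "sets (natural_filtration M N t) \<subseteq> sets (natural_filtration M N u)"
    unfolding natural_filtration_def
    by (subst (1 2) sets_measure_of) (auto intro!: sigma_sets_mono')
qed

text \<open>\<open>N(\<tau>)\<close>. The value \<open>N(0)\<close> taken where \<open>\<tau> = \<infinity>\<close> is only a convention: this is a null event
  when \<open>\<tau>\<close> has finite expectation.\<close>

definition count_at :: "(real \<Rightarrow> 'a \<Rightarrow> nat) \<Rightarrow> ('a \<Rightarrow> ennreal) \<Rightarrow> 'a \<Rightarrow> nat" where
  "count_at N \<tau> \<omega> = N (enn2real (\<tau> \<omega>)) \<omega>"

definition cumulative_wait :: "(real \<Rightarrow> 'a \<Rightarrow> nat) \<Rightarrow> ('a \<Rightarrow> ennreal) \<Rightarrow> 'a \<Rightarrow> ennreal" where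
  "cumulative_wait N \<tau> \<omega> = (\<integral>\<^sup>+u\<in>{u. 0 \<le> u \<and> ennreal u \<le> \<tau> \<omega>}. ennreal (real (N u \<omega>)) \<partial>lborel)"

definition average_order_delay ::
    "'a measure \<Rightarrow> (real \<Rightarrow> 'a \<Rightarrow> nat) \<Rightarrow> real \<Rightarrow> ('a \<Rightarrow> ennreal) \<Rightarrow> ennreal" where
  "average_order_delay M N rate \<tau> =
    (\<integral>\<^sup>+\<omega>. cumulative_wait N \<tau> \<omega> \<partial>M) / (ennreal rate * (\<integral>\<^sup>+\<omega>. \<tau> \<omega> \<partial>M))"

end

theory Submission
  imports Defs
begin

text \<open>
  All identities are instances of one: for every stopping time \<open>\<tau>\<close> that is almost surely finite
  and every \<open>j\<close>,
  \<open>E[N(\<tau>) choose (j + 1)] = rate * E[\<integral>\<^sub>0\<^sup>\<tau> (N(u) choose j) du]\<close>,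
  both sides possibly infinite (\<open>optional_sampling_choose\<close>). For \<open>j = 0\<close> this is
  \<open>E[N(\<tau>)] = rate * E[\<tau>]\<close>; for \<open>j = 1\<close> it is the statement about \<open>W(\<tau>)\<close>, since
  \<open>n\<^sup>2 - n = 2 * (n choose 2)\<close>. Binomial coefficients are the right test functions because the
  mean of \<open>X choose j\<close> for a Poisson variable \<open>X\<close> with parameter \<open>r\<close> is simply \<open>r ^ j / fact j\<close>.

  Over a deterministic interval \<open>[s, t]\<close> and an event \<open>A\<close> of the past of \<open>s\<close>, the increment
  \<open>N(u) - N(s)\<close> is independent of \<open>A\<close> and of \<open>N(s)\<close>, so Vandermonde's identity expresses
  \<open>E[1\<^sub>A (N(u) choose j)]\<close> as a polynomial in \<open>u - s\<close>. Integrating the polynomial for \<open>j\<close> gives the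
  one for \<open>j + 1\<close>, up to its constant term (\<open>nn_integral_past_choose_Suc\<close>): this is the identity
  for the interval, and Fubini's theorem moves the time integral inside.

  A stopping time on a grid is handled by summing over grid cells, with \<open>A\<close> the event that the time
  has not been reached (\<open>optional_sampling_grid\<close>). A bounded stopping time is the limit from above of
  grid stopping times; right continuity of the paths and domination by the value at the bound pass
  the identity to the limit (\<open>optional_sampling_bounded\<close>). Finally \<open>\<tau>\<close> is the increasing limit of
  \<open>min \<tau> n\<close>, where monotone convergence applies whether or not the expectations are finite.
  Working with nonnegative integrals throughout avoids integrability side conditions.
\<close>

section \<open>Factorial moments of the Poisson distribution\<close>

text \<open>Multiplying the weight \<open>r ^ k / fact k\<close> by \<open>k choose j\<close> cancels a factor, leaving
  \<open>r ^ j / fact j\<close> times an exponential series shifted by \<open>j\<close>.\<close>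

lemma nn_integral_poisson_choose:
  assumes "0 < r"
  shows "(\<integral>\<^sup>+k. of_nat (k choose j) \<partial>measure_pmf (poisson_pmf r)) = ennreal (r ^ j / fact j)"
proof -
  let ?f = "\<lambda>k. pmf (poisson_pmf r) k * real (k choose j)"
  have f_shift: "?f (k + j) = (r ^ j / fact j * exp (- r)) * (r ^ k /\<^sub>R fact k)" for k
    using assms
    by (simp add: binomial_fact power_add scaleR_conv_of_real field_simps)
  have "(\<lambda>k. ?f (k + j)) sums ((r ^ j / fact j * exp (- r)) * exp r)"
    unfolding f_shift by (intro sums_mult exp_converges)
  then have "?f sums (r ^ j / fact j * exp (- r) * exp r + (\<Sum>k<j. ?f k))"
    by (subst (asm) sums_iff_shift)
  then have s: "?f sums (r ^ j / fact j)"
    by (simp add: mult.assoc exp_add[symmetric] binomial_eq_0)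
  have "(\<integral>\<^sup>+k. of_nat (k choose j) \<partial>measure_pmf (poisson_pmf r)) = (\<integral>\<^sup>+k. ennreal (?f k) \<partial>count_space UNIV)"
    by (simp add: nn_integral_measure_pmf ennreal_mult ennreal_of_nat_eq_real_of_nat)
  also have "\<dots> = (\<Sum>k. ennreal (?f k))"
    by (simp add: nn_integral_count_space_nat)
  also have "\<dots> = ennreal (r ^ j / fact j)"
    using s by (intro suminf_ennreal_eq) auto
  finally show ?thesis .
qed

context poisson_process
begin

section \<open>Independence of the past and the next increment\<close>

lemma measurable_increment [measurable]:
  assumes "0 \<le> s" "s \<le> t"
  shows "(\<lambda>\<omega>. N t \<omega> - N s \<omega>) \<in> measurable M (count_space UNIV)"
proof -
  have [measurable]: "N s \<in> measurable M (count_space UNIV)" "N t \<in> measurable M (count_space UNIV)"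
    using assms by (auto intro: measurable_N)
  show ?thesis by measurable
qed

text \<open>Independence of increments speaks about one strictly increasing sequence of times. The finitely
  many observation times, together with \<open>0\<close> and \<open>s\<close>, are sorted into such a sequence ending in
  \<open>s\<close>, and \<open>t\<close> is appended. Since \<open>N\<close> starts at \<open>0\<close>, the observed values are partial sums of all
  increments but the last, so the cylinder depends on a block of increments independent of the last
  one.\<close>

lemma prob_cylinder_increment:
  assumes "finite J" "J \<subseteq> {0..s}" "0 \<le> s" "s < t"
  shows "prob ({\<omega>\<in>space M. \<forall>u\<in>J. N u \<omega> \<in> A u} \<inter> {\<omega>\<in>space M. N t \<omega> - N s \<omega> \<in> B}) =
    prob {\<omega>\<in>space M. \<forall>u\<in>J. N u \<omega> \<in> A u} * prob {\<omega>\<in>space M. N t \<omega> - N s \<omega> \<in> B}"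
proof -
  define J' where "J' = insert 0 (insert s J)"
  define xs where "xs = sorted_list_of_set J'"
  define n where "n = length xs - 1"
  define p where "p i = (xs @ [t]) ! i" for i
  have J': "finite J'" "0 \<in> J'" "s \<in> J'" "J' \<subseteq> {0..s}"
    using assms by (auto simp: J'_def)
  have set_xs: "set xs = J'"
    using J' by (simp add: xs_def)
  have len: "length xs = Suc n"
    using set_xs J' by (cases xs) (auto simp: n_def)
  have "sorted_wrt (<) xs"
    unfolding xs_def by simp
  moreover have "x < t" if "x \<in> set xs" for x
    using that J'(4) set_xs \<open>s < t\<close> by force
  ultimately have sw: "sorted_wrt (<) (xs @ [t])"
    by (simp add: sorted_wrt_append)
  have p_less: "p i < p k" if "i < k" "k \<le> Suc n" for i k
    unfolding p_def by (rule sorted_wrt_nth_less[OF sw]) (simp_all add: that len less_Suc_eq_le)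
  have p_xs: "p i = xs ! i" if "i \<le> n" for i
    using that by (simp add: p_def nth_append len)
  have p_J: "p i \<in> J'" if "i \<le> n" for i
    unfolding p_xs[OF that] set_xs[symmetric] by (rule nth_mem) (use that len in simp)
  have J_p: "\<exists>i\<le>n. u = p i" if u: "u \<in> J'" for u
  proof -
    obtain i where "i < length xs" "xs ! i = u"
      using u unfolding set_xs[symmetric] in_set_conv_nth by blast
    then show ?thesis
      using p_xs[of i] by (intro exI[of _ i]) (simp add: len)
  qed
  have p0: "p 0 = 0"
  proof -
    obtain i where "i \<le> n" "p i = 0" using J_p[OF J'(2)] by metis
    then have "p 0 \<le> 0"
      using p_less[of 0 i] by (cases "i = 0") force+
    moreover have "0 \<le> p 0"
      using p_J[of 0] J'(4) by (meson atLeastAtMost_iff le0 subsetD)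
    ultimately show ?thesis by simp
  qed
  have pn: "p n = s"
  proof -
    obtain i where i: "i \<le> n" "p i = s" using J_p[OF J'(3)] by metis
    then have "s \<le> p n"
      using p_less[of i n] by (cases "i = n") force+
    moreover have "p n \<le> s"
      using p_J[of n] J'(4) by (meson atLeastAtMost_iff order_refl subsetD)
    ultimately show ?thesis by simp
  qed
  have pSn: "p (Suc n) = t"
    using len by (simp add: p_def nth_append)
  define D where "D i \<omega> = N (p (Suc i)) \<omega> - N (p i) \<omega>" for i \<omega>
  have p_nonneg: "0 \<le> p i" if "i \<le> n" for i
    using p_J[OF that] J' by auto
  have N_p: "N (p i) \<omega> = (\<Sum>k<i. D k \<omega>)" if "\<omega> \<in> space M" "i \<le> n" for i \<omega>
    using that(2)
  proof (induction i)
    case 0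
    then show ?case using N_zero[OF that(1)] p0 by simp
  next
    case (Suc i)
    then have "N (p i) \<omega> \<le> N (p (Suc i)) \<omega>"
      using that p_nonneg[of i] p_less[of i "Suc i"] by (intro mono_path) auto
    with Suc show ?case by (simp add: D_def)
  qed
  have "indep_vars (\<lambda>_. count_space UNIV) D {..<Suc n}"
    unfolding D_def by (rule independent_increments) (use p0 p_less in auto)
  then have ind: "indep_var (PiM {..<n} (\<lambda>_. count_space UNIV)) (\<lambda>\<omega>. restrict (\<lambda>i. D i \<omega>) {..<n})
      (PiM {n} (\<lambda>_. count_space UNIV)) (\<lambda>\<omega>. restrict (\<lambda>i. D i \<omega>) {n})"
    by (rule indep_var_restrict) auto
  \<comment> \<open>The cylinder, read as a condition on the first \<open>n\<close> increments.\<close>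
  define P1 where "P1 = {d \<in> space (PiM {..<n} (\<lambda>_. count_space (UNIV::nat set))).
     \<forall>i\<in>{i. i \<le> n \<and> p i \<in> J}. (\<Sum>k<i. d k) \<in> A (p i)}"
  define P2 where "P2 = {d \<in> space (PiM {n} (\<lambda>_. count_space (UNIV::nat set))). d n \<in> B}"
  have P1: "P1 \<in> sets (PiM {..<n} (\<lambda>_. count_space UNIV))"
    unfolding P1_def
  proof (rule sets.sets_Collect_finite_All)
    fix i assume "i \<in> {i. i \<le> n \<and> p i \<in> J}"
    then have [measurable]: "(\<lambda>d. \<Sum>k<i. d k) \<in> measurable (PiM {..<n} (\<lambda>_. count_space (UNIV::nat set))) (count_space UNIV)"
      by (intro measurable_sum_nat measurable_component_singleton) auto
    show "{d \<in> space (PiM {..<n} (\<lambda>_. count_space (UNIV::nat set))). (\<Sum>k<i. d k) \<in> A (p i)}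
        \<in> sets (PiM {..<n} (\<lambda>_. count_space UNIV))"
      by measurable
  qed auto
  have P2: "P2 \<in> sets (PiM {n} (\<lambda>_. count_space UNIV))"
    unfolding P2_def by measurable
  have e1: "(\<lambda>\<omega>. restrict (\<lambda>i. D i \<omega>) {..<n}) -` P1 \<inter> space M = {\<omega>\<in>space M. \<forall>u\<in>J. N u \<omega> \<in> A u}"
  proof -
    have "(\<forall>i\<in>{i. i \<le> n \<and> p i \<in> J}. (\<Sum>k<i. restrict (\<lambda>i. D i \<omega>) {..<n} k) \<in> A (p i))
        \<longleftrightarrow> (\<forall>u\<in>J. N u \<omega> \<in> A u)" if "\<omega> \<in> space M" for \<omega>
    proof -
      have "(\<Sum>k<i. restrict (\<lambda>i. D i \<omega>) {..<n} k) = N (p i) \<omega>" if "i \<le> n" for i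
        unfolding N_p[OF \<open>\<omega> \<in> space M\<close> that] using that by (intro sum.cong) auto
      moreover have "\<exists>i\<le>n. u = p i" if "u \<in> J" for u
        using that J_p by (auto simp: J'_def)
      ultimately show ?thesis by (metis (mono_tags, lifting) mem_Collect_eq)
    qed
    then show ?thesis
      by (auto simp: P1_def space_PiM)
  qed
  have e2: "(\<lambda>\<omega>. restrict (\<lambda>i. D i \<omega>) {n}) -` P2 \<inter> space M = {\<omega>\<in>space M. N t \<omega> - N s \<omega> \<in> B}"
    by (auto simp: P2_def space_PiM D_def pn pSn)
  have e3: "(\<lambda>\<omega>. (restrict (\<lambda>i. D i \<omega>) {..<n}, restrict (\<lambda>i. D i \<omega>) {n})) -` (P1 \<times> P2) \<inter> space M
     = ((\<lambda>\<omega>. restrict (\<lambda>i. D i \<omega>) {..<n}) -` P1 \<inter> space M) \<inter> ((\<lambda>\<omega>. restrict (\<lambda>i. D i \<omega>) {n}) -` P2 \<inter> space M)"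
    by auto
  show ?thesis
    using indep_varD[OF ind P1 P2] unfolding e3 unfolding e1 e2 .
qed

lemma space_natural_filtration [simp]: "space (natural_filtration M N t) = space M"
  unfolding natural_filtration_def by (rule space_measure_of) auto

lemma sets_natural_filtration:
  "sets (natural_filtration M N t) =
    sigma_sets (space M) {N s -` A \<inter> space M | s A. 0 \<le> s \<and> ennreal s \<le> t}"
  unfolding natural_filtration_def by (rule sets_measure_of) auto

lemma sets_natural_filtration_subset: "sets (natural_filtration M N t) \<subseteq> events"
  unfolding sets_natural_filtration
  by (intro sets.sigma_sets_subset) (auto intro!: measurable_sets[OF measurable_N])

text \<open>Cylinder events over finitely many times up to \<open>s\<close> form an intersection-stable generator of
  the past, so independence extends from them to the whole \<open>\<sigma>\<close>-algebra.\<close>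

lemma indep_past_increment:
  assumes "0 \<le> s" "s < t"
  shows "indep_set (sets (natural_filtration M N (ennreal s)))
    (sigma_sets (space M) {(\<lambda>\<omega>. N t \<omega> - N s \<omega>) -` B \<inter> space M | B. B \<in> sets (count_space UNIV)})"
proof -
  define C where "C = {{\<omega>\<in>space M. \<forall>u\<in>J. N u \<omega> \<in> A u} | J A. finite J \<and> J \<subseteq> {0..s}}"
  define I where "I = {(\<lambda>\<omega>. N t \<omega> - N s \<omega>) -` B \<inter> space M | B. B \<in> sets (count_space (UNIV::nat set))}"
  have C_events: "C \<subseteq> events"
  proof
    fix E assume "E \<in> C"
    then obtain J A where E: "E = {\<omega>\<in>space M. \<forall>u\<in>J. N u \<omega> \<in> A u}" "finite J" "J \<subseteq> {0..s}"
      by (auto simp: C_def)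
    have "{\<omega>\<in>space M. N u \<omega> \<in> A u} \<in> events" if "u \<in> J" for u
      using measurable_sets[OF measurable_N, of u "A u"] that E(3) by (auto simp: vimage_def Int_def conj_commute)
    then show "E \<in> events"
      unfolding E(1) by (intro sets.sets_Collect_finite_All E(2))
  qed
  have "indep_set C I"
  proof (rule indep_setI)
    show "I \<subseteq> events"
      unfolding I_def using assms by (auto intro!: measurable_sets[OF measurable_increment])
  next
    fix a b assume "a \<in> C" "b \<in> I"
    then obtain J A B where *: "a = {\<omega>\<in>space M. \<forall>u\<in>J. N u \<omega> \<in> A u}" "finite J" "J \<subseteq> {0..s}"
      "b = {\<omega>\<in>space M. N t \<omega> - N s \<omega> \<in> B}"
      by (auto simp: C_def I_def)
    show "prob (a \<inter> b) = prob a * prob b"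
      unfolding *(1,4) by (rule prob_cylinder_increment) (use * assms in auto)
  qed (fact C_events)
  moreover have "Int_stable C"
  proof (rule Int_stableI)
    fix a b assume "a \<in> C" "b \<in> C"
    then obtain J A K B where *: "a = {\<omega>\<in>space M. \<forall>u\<in>J. N u \<omega> \<in> A u}" "finite J" "J \<subseteq> {0..s}"
      "b = {\<omega>\<in>space M. \<forall>u\<in>K. N u \<omega> \<in> B u}" "finite K" "K \<subseteq> {0..s}"
      by (auto simp: C_def)
    \<comment> \<open>A time observed by only one of the two cylinders is left unconstrained by the other.\<close>
    define A' where "A' u = (if u \<in> J then A u else UNIV) \<inter> (if u \<in> K then B u else UNIV)" for u
    have "a \<inter> b = {\<omega>\<in>space M. \<forall>u\<in>J\<union>K. N u \<omega> \<in> A' u}"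
      unfolding * A'_def by (auto split: if_splits)
    then show "a \<inter> b \<in> C"
      unfolding C_def using * by (intro CollectI exI[of _ "J \<union> K"] exI[of _ A']) auto
  qed
  moreover have "Int_stable I"
  proof (rule Int_stableI)
    fix a b assume "a \<in> I" "b \<in> I"
    then obtain A B where "a = (\<lambda>\<omega>. N t \<omega> - N s \<omega>) -` A \<inter> space M" "b = (\<lambda>\<omega>. N t \<omega> - N s \<omega>) -` B \<inter> space M"
      by (auto simp: I_def)
    then show "a \<inter> b \<in> I"
      unfolding I_def by (intro CollectI exI[of _ "A \<inter> B"]) auto
  qed
  ultimately have 1: "indep_set (sigma_sets (space M) C) (sigma_sets (space M) I)"
    by (rule indep_set_sigma_sets)
  have "sets (natural_filtration M N (ennreal s)) \<subseteq> sigma_sets (space M) C"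
    unfolding sets_natural_filtration
  proof (rule sigma_sets_mono, safe)
    fix r :: real and A assume "0 \<le> r" "ennreal r \<le> ennreal s"
    then have "N r -` A \<inter> space M \<in> C"
      unfolding C_def using assms by (intro CollectI exI[of _ "{r}"] exI[of _ "\<lambda>_. A"]) auto
    then show "N r -` A \<inter> space M \<in> sigma_sets (space M) C" ..
  qed
  then show ?thesis
    using 1 unfolding I_def[symmetric] indep_sets2_eq by blast
qed

section \<open>Expectations over events of the past\<close>

text \<open>The event \<open>A\<close> and the present value \<open>N s\<close> are both known at time \<open>s\<close>, so together they form
  a single variable independent of the increment.\<close>

lemma nn_integral_past_increment:
  fixes h g :: "nat \<Rightarrow> ennreal"
  assumes "0 \<le> s" "s < t" "A \<in> sets (natural_filtration M N (ennreal s))"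
  shows "(\<integral>\<^sup>+\<omega>. indicator A \<omega> * (h (N s \<omega>) * g (N t \<omega> - N s \<omega>)) \<partial>M) =
    (\<integral>\<^sup>+\<omega>. indicator A \<omega> * h (N s \<omega>) \<partial>M) * (\<integral>\<^sup>+\<omega>. g (N t \<omega> - N s \<omega>) \<partial>M)"
proof -
  define X where "X \<omega> = indicator A \<omega> * h (N s \<omega>)" for \<omega>
  define D where "D \<omega> = N t \<omega> - N s \<omega>" for \<omega>
  let ?C = "count_space (UNIV :: nat set)"
  have [measurable]: "D \<in> measurable M ?C"
    unfolding D_def using assms by (intro measurable_increment) auto
  have "N s \<in> measurable (natural_filtration M N (ennreal s)) ?C"
    using assms by (intro measurableI) (auto simp: sets_natural_filtration)
  then have X_past: "X \<in> borel_measurable (natural_filtration M N (ennreal s))"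
    using assms(3) unfolding X_def by measurable
  then have [measurable]: "X \<in> borel_measurable M"
    by (rule measurable_from_subalg[rotated])
      (simp add: subalgebra_def sets_natural_filtration_subset)
  define Z where "Z \<omega> = g (D \<omega>)" for \<omega>
  have [measurable]: "Z \<in> borel_measurable M"
    unfolding Z_def by measurable
  have "sigma_sets (space M) {X -` B \<inter> space M | B. B \<in> sets borel}
      \<subseteq> sets (natural_filtration M N (ennreal s))"
    using sets.sigma_sets_subset[of "{X -` B \<inter> space M | B. B \<in> sets borel}" "natural_filtration M N (ennreal s)"]
      measurable_sets[OF X_past] by auto
  moreover have "sigma_sets (space M) {Z -` B \<inter> space M | B. B \<in> sets borel}
      \<subseteq> sigma_sets (space M) {D -` B \<inter> space M | B. B \<in> sets ?C}"
  proof (rule sigma_sets_mono, safe)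
    fix B :: "ennreal set"
    have "Z -` B \<inter> space M = D -` (g -` B) \<inter> space M"
      by (auto simp: Z_def)
    then show "Z -` B \<inter> space M \<in> sigma_sets (space M) {D -` B \<inter> space M | B. B \<in> sets ?C}"
      by (intro sigma_sets.Basic) auto
  qed
  ultimately have "indep_set (sigma_sets (space M) {X -` B \<inter> space M | B. B \<in> sets borel})
      (sigma_sets (space M) {Z -` B \<inter> space M | B. B \<in> sets borel})"
    using indep_past_increment[OF assms(1,2), folded D_def] unfolding indep_sets2_eq by blast
  then have "indep_var borel X borel Z"
    unfolding indep_var_eq by simp
  then have eq: "distr M borel X \<Otimes>\<^sub>M distr M borel Z = distr M (borel \<Otimes>\<^sub>M borel) (\<lambda>\<omega>. (X \<omega>, Z \<omega>))"
    by (auto simp: indep_var_distribution_eq)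
  interpret ZM: prob_space "distr M borel Z" by (rule prob_space_distr) simp
  have "(\<integral>\<^sup>+\<omega>. X \<omega> * Z \<omega> \<partial>M) = (\<integral>\<^sup>+z. fst z * snd z \<partial>distr M (borel \<Otimes>\<^sub>M borel) (\<lambda>\<omega>. (X \<omega>, Z \<omega>)))"
    by (subst nn_integral_distr) auto
  also have "\<dots> = (\<integral>\<^sup>+x. \<integral>\<^sup>+y. x * y \<partial>distr M borel Z \<partial>distr M borel X)"
    unfolding eq[symmetric] by (subst ZM.nn_integral_fst[symmetric]) auto
  also have "\<dots> = (\<integral>\<^sup>+x. x \<partial>distr M borel X) * (\<integral>\<^sup>+y. y \<partial>distr M borel Z)"
    by (simp add: nn_integral_cmult nn_integral_multc)
  also have "\<dots> = (\<integral>\<^sup>+\<omega>. X \<omega> \<partial>M) * (\<integral>\<^sup>+\<omega>. Z \<omega> \<partial>M)"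
    by (simp add: nn_integral_distr)
  finally show ?thesis
    by (simp add: X_def Z_def D_def mult.assoc)
qed

lemma nn_integral_choose_increment:
  assumes "0 \<le> s" "s < t"
  shows "(\<integral>\<^sup>+\<omega>. of_nat ((N t \<omega> - N s \<omega>) choose j) \<partial>M) = ennreal ((rate * (t - s)) ^ j / fact j)"
proof -
  have "(\<integral>\<^sup>+\<omega>. of_nat ((N t \<omega> - N s \<omega>) choose j) \<partial>M) =
      (\<integral>\<^sup>+k. of_nat (k choose j) \<partial>distr M (count_space UNIV) (\<lambda>\<omega>. N t \<omega> - N s \<omega>))"
    using assms by (subst nn_integral_distr) auto
  then show ?thesis
    using assms rate_pos by (simp add: poisson_increments nn_integral_poisson_choose)
qed

lemma nn_integral_choose_finite:
  assumes "0 \<le> t"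
  shows "(\<integral>\<^sup>+\<omega>. of_nat (N t \<omega> choose j) \<partial>M) < \<infinity>"
proof (cases "t = 0")
  case True
  have "(\<integral>\<^sup>+\<omega>. of_nat (N t \<omega> choose j) \<partial>M) = (\<integral>\<^sup>+\<omega>. of_nat (0 choose j) \<partial>M)"
    using N_zero True by (intro nn_integral_cong) simp
  then show ?thesis by (simp add: emeasure_space_1 of_nat_less_top)
next
  case False
  have "(\<integral>\<^sup>+\<omega>. of_nat (N t \<omega> choose j) \<partial>M) = (\<integral>\<^sup>+\<omega>. of_nat ((N t \<omega> - N 0 \<omega>) choose j) \<partial>M)"
    using N_zero by (intro nn_integral_cong) simp
  also have "\<dots> < \<infinity>"
    using False assms by (subst nn_integral_choose_increment) auto
  finally show ?thesis .
qed

text \<open>Vandermonde's identity separates \<open>N s\<close> from the increment inside \<open>N u choose j\<close>. The point of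
  the formula is that the right-hand side is an explicit polynomial in \<open>u - s\<close>.\<close>

lemma nn_integral_past_choose:
  assumes "0 \<le> s" "s \<le> u" and A: "A \<in> sets (natural_filtration M N (ennreal s))"
  shows "(\<integral>\<^sup>+\<omega>. indicator A \<omega> * of_nat (N u \<omega> choose j) \<partial>M) =
    (\<Sum>i\<le>j. (\<integral>\<^sup>+\<omega>. indicator A \<omega> * of_nat (N s \<omega> choose i) \<partial>M)
       * ennreal ((rate * (u - s)) ^ (j - i) / fact (j - i)))"
proof (cases "s = u")
  case True
  have "(\<Sum>i\<le>j. (\<integral>\<^sup>+\<omega>. indicator A \<omega> * of_nat (N s \<omega> choose i) \<partial>M)
       * ennreal ((rate * (u - s)) ^ (j - i) / fact (j - i)))
    = (\<Sum>i\<le>j. if i = j then (\<integral>\<^sup>+\<omega>. indicator A \<omega> * of_nat (N s \<omega> choose i) \<partial>M) else 0)"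
    using True by (intro sum.cong) (auto simp: power_0_left)
  then show ?thesis using True by simp
next
  case False
  then have "s < u" using assms by simp
  have [measurable]: "N s \<in> measurable M (count_space UNIV)" "N u \<in> measurable M (count_space UNIV)"
    using assms by (auto intro: measurable_N)
  have [measurable]: "A \<in> sets M"
    using A sets_natural_filtration_subset by blast
  have "(\<integral>\<^sup>+\<omega>. indicator A \<omega> * of_nat (N u \<omega> choose j) \<partial>M) =
    (\<integral>\<^sup>+\<omega>. (\<Sum>i\<le>j. indicator A \<omega> * (of_nat (N s \<omega> choose i) * of_nat ((N u \<omega> - N s \<omega>) choose (j - i)))) \<partial>M)"
  proof (intro nn_integral_cong)
    fix \<omega> assume "\<omega> \<in> space M"
    then have "N u \<omega> = N s \<omega> + (N u \<omega> - N s \<omega>)"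
      using mono_path[of \<omega> s u] assms by simp
    then have "N u \<omega> choose j = (\<Sum>i\<le>j. (N s \<omega> choose i) * ((N u \<omega> - N s \<omega>) choose (j - i)))"
      using vandermonde[of "N s \<omega>" "N u \<omega> - N s \<omega>" j] by simp
    then show "indicator A \<omega> * of_nat (N u \<omega> choose j) =
      (\<Sum>i\<le>j. indicator A \<omega> * (of_nat (N s \<omega> choose i) * of_nat ((N u \<omega> - N s \<omega>) choose (j - i)) :: ennreal))"
      by (simp add: sum_distrib_left)
  qed
  also have "\<dots> = (\<Sum>i\<le>j. \<integral>\<^sup>+\<omega>. indicator A \<omega> * (of_nat (N s \<omega> choose i) * of_nat ((N u \<omega> - N s \<omega>) choose (j - i))) \<partial>M)"
    by (rule nn_integral_sum) measurable
  also have "\<dots> = (\<Sum>i\<le>j. (\<integral>\<^sup>+\<omega>. indicator A \<omega> * of_nat (N s \<omega> choose i) \<partial>M)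
       * ennreal ((rate * (u - s)) ^ (j - i) / fact (j - i)))"
    by (intro sum.cong refl, subst nn_integral_past_increment[OF assms(1) \<open>s < u\<close> A])
      (simp add: nn_integral_choose_increment[OF assms(1) \<open>s < u\<close>])
  finally show ?thesis .
qed

text \<open>The main identity over a deterministic time interval, restricted to an event of the past. Integrating
  \<open>(rate * (u - s)) ^ m / fact m\<close> against \<open>rate\<close> raises \<open>m\<close> by one, so the polynomial for \<open>j\<close>
  integrates to the polynomial for \<open>j + 1\<close> without its constant term, which is the expectation at
  \<open>s\<close>.\<close>

lemma nn_integral_past_choose_Suc:
  assumes "0 \<le> s" "s \<le> t" and A: "A \<in> sets (natural_filtration M N (ennreal s))"
  shows "(\<integral>\<^sup>+\<omega>. indicator A \<omega> * of_nat (N t \<omega> choose Suc j) \<partial>M) =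
    (\<integral>\<^sup>+\<omega>. indicator A \<omega> * of_nat (N s \<omega> choose Suc j) \<partial>M) +
    ennreal rate * (\<integral>\<^sup>+u. (\<integral>\<^sup>+\<omega>. indicator A \<omega> * of_nat (N u \<omega> choose j) \<partial>M) * indicator {s..t} u \<partial>lborel)"
proof -
  define a where "a i = (\<integral>\<^sup>+\<omega>. indicator A \<omega> * of_nat (N s \<omega> choose i) \<partial>M)" for i
  define q where "q m u = (rate * (u - s)) ^ m / fact m" for m u
  have q_meas [measurable]: "q m \<in> borel_measurable borel" for m
    unfolding q_def by measurable
  have q_int: "ennreal rate * (\<integral>\<^sup>+u. ennreal (q m u) * indicator {s..t} u \<partial>lborel) = ennreal (q (Suc m) t)" for m
  proof -
    have "ennreal rate * (\<integral>\<^sup>+u. ennreal (q m u) * indicator {s..t} u \<partial>lborel)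
        = (\<integral>\<^sup>+u. ennreal (rate * q m u) * indicator {s..t} u \<partial>lborel)"
      using rate_pos by (simp add: nn_integral_cmult[symmetric] ennreal_mult' mult.assoc)
    also have "\<dots> = ennreal (q (Suc m) t - q (Suc m) s)"
    proof (rule nn_integral_FTC_Icc)
      fix u assume "u \<in> {s..t}"
      then show "0 \<le> rate * q m u"
        using rate_pos by (auto simp: q_def)
      show "DERIV (q (Suc m)) u :> rate * q m u"
        unfolding q_def by (rule derivative_eq_intros refl | simp add: field_simps del: of_nat_Suc)+
    qed (use assms in auto)
    also have "q (Suc m) s = 0"
      by (simp add: q_def)
    finally show ?thesis by simp
  qed
  have "(\<integral>\<^sup>+u. (\<integral>\<^sup>+\<omega>. indicator A \<omega> * of_nat (N u \<omega> choose j) \<partial>M) * indicator {s..t} u \<partial>lborel)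
      = (\<integral>\<^sup>+u. (\<Sum>i\<le>j. a i * (ennreal (q (j - i) u) * indicator {s..t} u)) \<partial>lborel)"
    unfolding a_def q_def
    by (intro nn_integral_cong)
      (auto split: split_indicator simp: nn_integral_past_choose[OF assms(1) _ A])
  also have "\<dots> = (\<Sum>i\<le>j. a i * (\<integral>\<^sup>+u. ennreal (q (j - i) u) * indicator {s..t} u \<partial>lborel))"
    by (simp add: nn_integral_sum nn_integral_cmult)
  finally have "ennreal rate * (\<integral>\<^sup>+u. (\<integral>\<^sup>+\<omega>. indicator A \<omega> * of_nat (N u \<omega> choose j) \<partial>M) * indicator {s..t} u \<partial>lborel)
      = (\<Sum>i\<le>j. a i * (ennreal rate * (\<integral>\<^sup>+u. ennreal (q (j - i) u) * indicator {s..t} u \<partial>lborel)))"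
    by (simp add: sum_distrib_left mult.left_commute)
  also have "\<dots> = (\<Sum>i\<le>j. a i * ennreal (q (Suc j - i) t))"
    by (intro sum.cong refl) (simp add: q_int Suc_diff_le)
  finally show ?thesis
    unfolding nn_integral_past_choose[OF assms]
    by (simp add: a_def q_def add.commute)
qed

end

section \<open>Approximation from above by a grid\<close>

definition grid_index :: "real \<Rightarrow> real \<Rightarrow> nat" where
  "grid_index h r = nat \<lceil>r / h\<rceil>"

text \<open>This makes the discretised time adapted: whether it exceeds grid point \<open>k\<close> is decided by
  comparing the original time with \<open>k * h\<close>.\<close>

lemma less_grid_index_iff:
  assumes "0 < h"
  shows "k < grid_index h r \<longleftrightarrow> real k * h < r"
  using assms by (simp add: grid_index_def zless_nat_eq_int_zless less_ceiling_iff pos_less_divide_eq)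

lemma grid_index_bounds:
  assumes "0 < h" "0 \<le> r"
  shows "r \<le> real (grid_index h r) * h" "real (grid_index h r) * h < r + h"
proof -
  have eq: "real (grid_index h r) = of_int \<lceil>r / h\<rceil>"
    using assms by (simp add: grid_index_def)
  have "r / h \<le> real (grid_index h r)" "real (grid_index h r) < r / h + 1"
    unfolding eq by linarith+
  then show "r \<le> real (grid_index h r) * h" "real (grid_index h r) * h < r + h"
    using assms by (simp_all add: field_simps)
qed

lemma measurable_grid_index [measurable]: "grid_index h \<in> measurable borel (count_space UNIV)"
  unfolding grid_index_def by measurable

lemma grid_tendsto:
  assumes "0 < T" "0 \<le> r"
  shows "(\<lambda>n. real (grid_index (T / real (Suc n)) r) * (T / real (Suc n))) \<longlonglongrightarrow> r"
proof (rule real_tendsto_sandwich[OF always_eventually always_eventually])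
  show "(\<lambda>n. r) \<longlonglongrightarrow> r" by simp
  have "(\<lambda>n. r + T * inverse (real (Suc n))) \<longlonglongrightarrow> r + T * 0"
    by (intro tendsto_intros LIMSEQ_inverse_real_of_nat)
  then show "(\<lambda>n. r + T / real (Suc n)) \<longlonglongrightarrow> r"
    by (simp add: divide_inverse)
qed (use assms grid_index_bounds[of "T / real (Suc _)" r] in \<open>auto simp: less_imp_le\<close>)

lemma SUP_eventually_constant:
  fixes f :: "nat \<Rightarrow> 'b :: {complete_linorder, linorder_topology}"
  assumes "incseq f" "eventually (\<lambda>n. f n = c) sequentially"
  shows "(SUP n. f n) = c"
  using LIMSEQ_unique[OF LIMSEQ_SUP[OF assms(1)] tendsto_eventually[OF assms(2)]] .

context poisson_process
begin

lemma eventually_N_eq: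
  assumes "\<omega> \<in> space M" "0 \<le> t" "x \<longlonglongrightarrow> t" "\<And>n. t \<le> x n"
  shows "eventually (\<lambda>n. N (x n) \<omega> = N t \<omega>) sequentially"
proof -
  have "((\<lambda>u. N u \<omega>) \<longlongrightarrow> N t \<omega>) (at_right t)"
    using right_continuous_path[OF assms(1,2)] by (simp add: continuous_within)
  then have "eventually (\<lambda>u. N u \<omega> = N t \<omega>) (at_right t)"
    by (simp add: tendsto_discrete)
  then obtain b where b: "b > t" "\<And>u. t < u \<Longrightarrow> u < b \<Longrightarrow> N u \<omega> = N t \<omega>"
    unfolding eventually_at_right_field by blast
  have "eventually (\<lambda>n. x n < b) sequentially"
    using order_tendstoD(2)[OF assms(3) b(1)] .
  then show ?thesis
  proof eventually_elim
    case (elim n)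
    then show ?case
      using b(2)[of "x n"] assms(4)[of n] by (cases "x n = t") auto
  qed
qed

text \<open>Right continuity gives joint measurability: \<open>N\<close> at time \<open>u\<close> is eventually equal to \<open>N\<close> at grid
  points tending from the right to \<open>u\<close>, and evaluation at a time taking countably many values is measurable.
  Truncating the time at \<open>0\<close> is needed because nothing is known about \<open>N\<close> at negative times.\<close>

lemma measurable_N_pair: "(\<lambda>(u, \<omega>). N (max 0 u) \<omega>) \<in> measurable (borel \<Otimes>\<^sub>M M) (count_space UNIV)"
proof -
  define F where "F n z = N (real (grid_index (1 / real (Suc n)) (max 0 (fst z))) * (1 / real (Suc n))) (snd z)"
    for n and z :: "real \<times> 'a"
  have [measurable]: "F n \<in> measurable (borel \<Otimes>\<^sub>M M) (count_space UNIV)" for n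
    unfolding F_def
  proof (rule measurable_compose_countable[where f = "\<lambda>k z. N (real k * (1 / real (Suc n))) (snd z)"])
    show "(\<lambda>z. N (real k * (1 / real (Suc n))) (snd z)) \<in> measurable (borel \<Otimes>\<^sub>M M) (count_space UNIV)" for k
      by (rule measurable_compose[OF measurable_snd measurable_N]) simp
  qed measurable
  have ev: "eventually (\<lambda>n. F n z = N (max 0 (fst z)) (snd z)) sequentially" if "z \<in> space (borel \<Otimes>\<^sub>M M)" for z
    unfolding F_def
  proof (rule eventually_N_eq)
    show "snd z \<in> space M" using that by (auto simp: space_pair_measure)
    show "max 0 (fst z) \<le> real (grid_index (1 / real (Suc n)) (max 0 (fst z))) * (1 / real (Suc n))" for n
      by (rule grid_index_bounds) simp_all
    show "(\<lambda>n. real (grid_index (1 / real (Suc n)) (max 0 (fst z))) * (1 / real (Suc n))) \<longlonglongrightarrow> max 0 (fst z)"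
      by (rule grid_tendsto) simp_all
  qed simp
  have "(N (max 0 (fst z)) (snd z) = k) \<longleftrightarrow> eventually (\<lambda>n. F n z = k) sequentially"
    if "z \<in> space (borel \<Otimes>\<^sub>M M)" for z k
  proof
    assume "eventually (\<lambda>n. F n z = k) sequentially"
    with ev[OF that] have "eventually (\<lambda>n. N (max 0 (fst z)) (snd z) = k) sequentially"
      by eventually_elim simp
    then show "N (max 0 (fst z)) (snd z) = k" by simp
  qed (use ev[OF that] in simp)
  then have "(\<lambda>(u, \<omega>). N (max 0 u) \<omega>) -` {k} \<inter> space (borel \<Otimes>\<^sub>M M)
      = {z \<in> space (borel \<Otimes>\<^sub>M M). eventually (\<lambda>n. F n z = k) sequentially}" for k
    unfolding vimage_def case_prod_beta by blast
  then show ?thesis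
    by (subst measurable_count_space_eq2_countable) auto
qed

lemma measurable_N_compose [measurable (raw)]:
  assumes "r \<in> borel_measurable L" "X \<in> measurable L M"
  shows "(\<lambda>x. N (max 0 (r x)) (X x)) \<in> measurable L (count_space UNIV)"
  using measurable_compose[OF measurable_Pair[OF assms] measurable_N_pair] by simp

lemma measurable_N_random_time:
  assumes "r \<in> borel_measurable M" "\<And>\<omega>. 0 \<le> r \<omega>"
  shows "(\<lambda>\<omega>. N (r \<omega>) \<omega>) \<in> measurable M (count_space UNIV)"
  using measurable_N_compose[OF assms(1), of "\<lambda>\<omega>. \<omega>"] assms(2) by (simp add: max_absorb2)

lemma measurable_N_path: "\<omega> \<in> space M \<Longrightarrow> (\<lambda>u. N (max 0 u) \<omega>) \<in> measurable borel (count_space UNIV)"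
  by measurable

section \<open>The time integral along a path\<close>

text \<open>The truncation at \<open>0\<close> does not change the integrand on the interval; it makes the integrand
  measurable on the whole line.\<close>

definition choose_integral :: "nat \<Rightarrow> real \<Rightarrow> 'a \<Rightarrow> ennreal" where
  "choose_integral j r \<omega> = (\<integral>\<^sup>+u. of_nat (N (max 0 u) \<omega> choose j) * indicator {0..r} u \<partial>lborel)"

lemma measurable_choose_integral:
  assumes [measurable]: "r \<in> borel_measurable M"
  shows "(\<lambda>\<omega>. choose_integral j (r \<omega>) \<omega>) \<in> borel_measurable M"
proof -
  have *: "indicator {0..r \<omega>} u = (if 0 \<le> u \<and> u \<le> r \<omega> then 1 else 0 :: ennreal)" for u \<omega>
    by (auto simp: indicator_def)
  show ?thesis
    unfolding choose_integral_def * by measurable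
qed

lemma choose_integral_zero [simp]: "choose_integral j 0 \<omega> = 0"
proof -
  have "AE u in lborel. u \<noteq> (0::real)"
    by (rule AE_lborel_singleton)
  then have "choose_integral j 0 \<omega> = (\<integral>\<^sup>+u. 0 \<partial>(lborel :: real measure))"
    unfolding choose_integral_def
    by (intro nn_integral_cong_AE, eventually_elim) (simp add: indicator_def)
  then show ?thesis by simp
qed

lemma choose_integral_add:
  assumes "\<omega> \<in> space M" "0 \<le> s" "s \<le> t"
  shows "choose_integral j t \<omega> = choose_integral j s \<omega> +
    (\<integral>\<^sup>+u. of_nat (N (max 0 u) \<omega> choose j) * indicator {s..t} u \<partial>lborel)"
proof -
  note [measurable] = measurable_N_path[OF assms(1)]
  have "AE u in lborel. u \<noteq> s"
    by (rule AE_lborel_singleton)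
  then have "choose_integral j t \<omega> = (\<integral>\<^sup>+u. of_nat (N (max 0 u) \<omega> choose j) * indicator {0..s} u +
      of_nat (N (max 0 u) \<omega> choose j) * indicator {s..t} u \<partial>lborel)"
    unfolding choose_integral_def
    by (intro nn_integral_cong_AE, eventually_elim) (use assms in \<open>auto simp: indicator_def\<close>)
  also have "\<dots> = choose_integral j s \<omega> +
    (\<integral>\<^sup>+u. of_nat (N (max 0 u) \<omega> choose j) * indicator {s..t} u \<partial>lborel)"
    unfolding choose_integral_def by (rule nn_integral_add) measurable
  finally show ?thesis .
qed

lemma choose_integral_mono: "r \<le> t \<Longrightarrow> choose_integral j r \<omega> \<le> choose_integral j t \<omega>"
  unfolding choose_integral_def by (intro nn_integral_mono) (auto simp: indicator_def)

lemma choose_mono_path: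
  assumes "\<omega> \<in> space M" "0 \<le> s" "s \<le> t"
  shows "(of_nat (N s \<omega> choose j) :: ennreal) \<le> of_nat (N t \<omega> choose j)"
  using binomial_right_mono[OF mono_path[OF assms], of j] by (simp only: of_nat_mono)

lemma choose_integral_le:
  assumes "\<omega> \<in> space M" "0 \<le> T"
  shows "choose_integral j T \<omega> \<le> of_nat (N T \<omega> choose j) * ennreal T"
proof -
  have "choose_integral j T \<omega> \<le> (\<integral>\<^sup>+u. of_nat (N T \<omega> choose j) * indicator {0..T} u \<partial>lborel)"
    unfolding choose_integral_def using choose_mono_path[OF assms(1)]
    by (intro nn_integral_mono) (auto simp: indicator_def)
  also have "\<dots> = of_nat (N T \<omega> choose j) * ennreal T"
    using assms by (simp add: nn_integral_cmult)
  finally show ?thesis .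
qed

lemma choose_integral_tendsto:
  assumes \<omega>: "\<omega> \<in> space M" and x: "x \<longlonglongrightarrow> r" "\<And>n. r \<le> x n" "\<And>n. x n \<le> T" and "0 \<le> r"
  shows "(\<lambda>n. choose_integral j (x n) \<omega>) \<longlonglongrightarrow> choose_integral j r \<omega>"
  unfolding choose_integral_def
proof (rule nn_integral_dominated_convergence)
  note [measurable] = measurable_N_path[OF \<omega>]
  have "(\<lambda>u. of_nat (N (max 0 u) \<omega> choose j) * indicator {0..y} u :: ennreal) \<in> borel_measurable borel" for y
    by measurable
  then show "(\<lambda>u. of_nat (N (max 0 u) \<omega> choose j) * indicator {0..T} u :: ennreal) \<in> borel_measurable lborel"
    "(\<lambda>u. of_nat (N (max 0 u) \<omega> choose j) * indicator {0..r} u :: ennreal) \<in> borel_measurable lborel"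
    "\<And>n. (\<lambda>u. of_nat (N (max 0 u) \<omega> choose j) * indicator {0..x n} u :: ennreal) \<in> borel_measurable lborel"
    by simp_all
  have "0 \<le> T"
    using \<open>0 \<le> r\<close> x(2)[of 0] x(3)[of 0] by simp
  then show "(\<integral>\<^sup>+u. of_nat (N (max 0 u) \<omega> choose j) * indicator {0..T} u \<partial>lborel) < \<infinity>"
    by (intro le_less_trans[OF choose_integral_le[OF \<omega>, unfolded choose_integral_def]])
      (simp_all add: ennreal_mult_less_top of_nat_less_top)
  show "AE u in lborel. of_nat (N (max 0 u) \<omega> choose j) * indicator {0..x n} u
      \<le> (of_nat (N (max 0 u) \<omega> choose j) * indicator {0..T} u :: ennreal)" for n
    using x(3)[of n] by (intro AE_I2) (auto simp: indicator_def)
  show "AE u in lborel. (\<lambda>n. of_nat (N (max 0 u) \<omega> choose j) * indicator {0..x n} u)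
      \<longlonglongrightarrow> (of_nat (N (max 0 u) \<omega> choose j) * indicator {0..r} u :: ennreal)"
  proof (intro AE_I2 tendsto_eventually)
    fix u
    show "eventually (\<lambda>n. of_nat (N (max 0 u) \<omega> choose j) * indicator {0..x n} u
      = (of_nat (N (max 0 u) \<omega> choose j) * indicator {0..r} u :: ennreal)) sequentially"
    proof (cases "u \<le> r")
      case True
      then have "u \<le> x n" for n using x(2)[of n] by simp
      with True show ?thesis by (simp add: indicator_def)
    next
      case False
      then have "eventually (\<lambda>n. x n < u) sequentially"
        using order_tendstoD(2)[OF x(1)] by simp
      then show ?thesis
        by eventually_elim (use False in \<open>simp add: indicator_def\<close>)
    qed
  qed
qed

lemma choose_integral_0_eq: "0 \<le> r \<Longrightarrow> choose_integral 0 r \<omega> = ennreal r"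
  by (simp add: choose_integral_def)

section \<open>Optional sampling\<close>

text \<open>The two growth amounts over a time interval are stated through a common \<open>d\<close>, as sums rather
  than differences, so that they can be added up over grid cells without knowing that the integrals
  are finite.\<close>

lemma past_event_increments:
  assumes st: "0 \<le> s" "s \<le> t" and A: "A \<in> sets (natural_filtration M N (ennreal s))"
  obtains d where
    "(\<integral>\<^sup>+\<omega>. indicator A \<omega> * of_nat (N t \<omega> choose Suc j) \<partial>M) =
      (\<integral>\<^sup>+\<omega>. indicator A \<omega> * of_nat (N s \<omega> choose Suc j) \<partial>M) + ennreal rate * d"
    "(\<integral>\<^sup>+\<omega>. indicator A \<omega> * choose_integral j t \<omega> \<partial>M) = (\<integral>\<^sup>+\<omega>. indicator A \<omega> * choose_integral j s \<omega> \<partial>M) + d"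
proof -
  have [measurable]: "A \<in> sets M"
    using A sets_natural_filtration_subset by blast
  define d where "d = (\<integral>\<^sup>+\<omega>. indicator A \<omega> *
      (\<integral>\<^sup>+u. of_nat (N (max 0 u) \<omega> choose j) * indicator {s..t} u \<partial>lborel) \<partial>M)"
  interpret P: pair_sigma_finite M lborel
    by (intro pair_sigma_finite.intro sigma_finite_measure_axioms lborel.sigma_finite_measure_axioms)
  have "(\<integral>\<^sup>+u. (\<integral>\<^sup>+\<omega>. indicator A \<omega> * of_nat (N u \<omega> choose j) \<partial>M) * indicator {s..t} u \<partial>lborel)
      = (\<integral>\<^sup>+u. (\<integral>\<^sup>+\<omega>. indicator A \<omega> * of_nat (N (max 0 u) \<omega> choose j) \<partial>M) * indicator {s..t} u \<partial>lborel)"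
    using st by (intro nn_integral_cong) (auto split: split_indicator)
  also have "\<dots> = (\<integral>\<^sup>+u. (\<integral>\<^sup>+\<omega>. indicator A \<omega> * of_nat (N (max 0 u) \<omega> choose j) * indicator {s..t} u \<partial>M) \<partial>lborel)"
    by (rule nn_integral_cong, rule nn_integral_multc[symmetric]) measurable
  also have "\<dots> = (\<integral>\<^sup>+\<omega>. (\<integral>\<^sup>+u. indicator A \<omega> * of_nat (N (max 0 u) \<omega> choose j) * indicator {s..t} u \<partial>lborel) \<partial>M)"
    by (rule P.Fubini') measurable
  also have "\<dots> = d"
    unfolding d_def
  proof (intro nn_integral_cong)
    fix \<omega> assume "\<omega> \<in> space M"
    note [measurable] = measurable_N_path[OF this]
    show "(\<integral>\<^sup>+u. indicator A \<omega> * of_nat (N (max 0 u) \<omega> choose j) * indicator {s..t} u \<partial>lborel)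
      = indicator A \<omega> * (\<integral>\<^sup>+u. of_nat (N (max 0 u) \<omega> choose j) * indicator {s..t} u \<partial>lborel)"
      unfolding mult.assoc by (rule nn_integral_cmult) measurable
  qed
  finally have 1: "(\<integral>\<^sup>+\<omega>. indicator A \<omega> * of_nat (N t \<omega> choose Suc j) \<partial>M) =
      (\<integral>\<^sup>+\<omega>. indicator A \<omega> * of_nat (N s \<omega> choose Suc j) \<partial>M) + ennreal rate * d"
    using nn_integral_past_choose_Suc[OF assms, of j] by simp
  have [measurable]: "choose_integral j s \<in> borel_measurable M"
    using measurable_choose_integral[of "\<lambda>_. s" j] by simp
  have "(\<integral>\<^sup>+\<omega>. indicator A \<omega> * choose_integral j t \<omega> \<partial>M) =
     (\<integral>\<^sup>+\<omega>. indicator A \<omega> * choose_integral j s \<omega> + indicator A \<omega> *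
      (\<integral>\<^sup>+u. of_nat (N (max 0 u) \<omega> choose j) * indicator {s..t} u \<partial>lborel) \<partial>M)"
    by (intro nn_integral_cong) (simp add: choose_integral_add[OF _ st] distrib_left)
  also have "\<dots> = (\<integral>\<^sup>+\<omega>. indicator A \<omega> * choose_integral j s \<omega> \<partial>M) + d"
    unfolding d_def by (rule nn_integral_add) measurable
  finally show ?thesis
    using that 1 by blast
qed

text \<open>Induction over the grid cells. From \<open>K\<close> to \<open>Suc K\<close> the stopped process moves only on the event
  that \<open>m\<close> exceeds \<open>K\<close>, which is known at the left end of the cell.\<close>

lemma optional_sampling_grid:
  fixes m :: "'a \<Rightarrow> nat"
  assumes h: "0 \<le> h"
    and m: "\<And>k. {\<omega>\<in>space M. k < m \<omega>} \<in> sets (natural_filtration M N (ennreal (real k * h)))"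
  shows "(\<integral>\<^sup>+\<omega>. of_nat (N (real (min (m \<omega>) K) * h) \<omega> choose Suc j) \<partial>M) =
    ennreal rate * (\<integral>\<^sup>+\<omega>. choose_integral j (real (min (m \<omega>) K) * h) \<omega> \<partial>M)"
proof (induction K)
  case 0
  have "(\<integral>\<^sup>+\<omega>. of_nat (N 0 \<omega> choose Suc j) \<partial>M) = (\<integral>\<^sup>+\<omega>. 0 \<partial>M)"
    by (intro nn_integral_cong) (simp add: N_zero)
  then show ?case by simp
next
  case (Suc K)
  define A where "A = {\<omega>\<in>space M. K < m \<omega>}"
  have [measurable]: "{\<omega>\<in>space M. k < m \<omega>} \<in> sets M" for k
    using m sets_natural_filtration_subset by blast
  have m_meas [measurable]: "m \<in> measurable M (count_space UNIV)"
  proof (subst measurable_count_space_eq2_countable, safe)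
    fix k
    have "m -` {k} \<inter> space M = {\<omega>\<in>space M. \<not> k < m \<omega> \<and> (\<forall>i<k. i < m \<omega>)}"
      by (auto simp: not_less intro: antisym) (metis le_antisym nat_le_linear nat_less_le order_refl)
    also have "\<dots> \<in> sets M" by measurable
    finally show "m -` {k} \<inter> space M \<in> sets M" .
  qed auto
  have [measurable]: "A \<in> sets M"
    unfolding A_def by measurable
  have h_meas: "(\<lambda>\<omega>. real (min (m \<omega>) k) * h) \<in> borel_measurable M" for k
    by measurable
  have [measurable]: "(\<lambda>\<omega>. N (real (min (m \<omega>) k) * h) \<omega>) \<in> measurable M (count_space UNIV)"
    "(\<lambda>\<omega>. choose_integral j (real (min (m \<omega>) k) * h) \<omega>) \<in> borel_measurable M" for k
    using measurable_N_random_time[OF h_meas] measurable_choose_integral[OF h_meas] h by auto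
  have split: "(\<integral>\<^sup>+\<omega>. F (min (m \<omega>) k) \<omega> \<partial>M) = (\<integral>\<^sup>+\<omega>. indicator A \<omega> * F k \<omega> \<partial>M) +
      (\<integral>\<^sup>+\<omega>. indicator (space M - A) \<omega> * F (min (m \<omega>) K) \<omega> \<partial>M)"
    if k: "k = K \<or> k = Suc K" and [measurable]: "\<And>k. (\<lambda>\<omega>. F (min (m \<omega>) k) \<omega>) \<in> borel_measurable M" "\<And>k. F k \<in> borel_measurable M"
    for k and F :: "nat \<Rightarrow> 'a \<Rightarrow> ennreal"
  proof -
    have "(\<integral>\<^sup>+\<omega>. F (min (m \<omega>) k) \<omega> \<partial>M) =
        (\<integral>\<^sup>+\<omega>. indicator A \<omega> * F k \<omega> + indicator (space M - A) \<omega> * F (min (m \<omega>) K) \<omega> \<partial>M)"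
    proof (intro nn_integral_cong)
      fix \<omega> assume \<omega>: "\<omega> \<in> space M"
      show "F (min (m \<omega>) k) \<omega> = indicator A \<omega> * F k \<omega> + indicator (space M - A) \<omega> * F (min (m \<omega>) K) \<omega>"
      proof (cases "K < m \<omega>")
        case True
        then have "min (m \<omega>) k = k" using k by auto
        then show ?thesis using True \<omega> by (simp add: A_def)
      next
        case False
        then have "min (m \<omega>) k = min (m \<omega>) K" using k by auto
        then show ?thesis using False \<omega> by (simp add: A_def)
      qed
    qed
    also have "\<dots> = (\<integral>\<^sup>+\<omega>. indicator A \<omega> * F k \<omega> \<partial>M) +
      (\<integral>\<^sup>+\<omega>. indicator (space M - A) \<omega> * F (min (m \<omega>) K) \<omega> \<partial>M)"
      by (rule nn_integral_add) measurable
    finally show ?thesis .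
  qed
  define F G where "F k \<omega> = (of_nat (N (real k * h) \<omega> choose Suc j) :: ennreal)"
    and "G k \<omega> = choose_integral j (real k * h) \<omega>" for k \<omega>
  have FG [measurable]: "(\<lambda>\<omega>. F (min (m \<omega>) k) \<omega>) \<in> borel_measurable M" "(\<lambda>\<omega>. G (min (m \<omega>) k) \<omega>) \<in> borel_measurable M" for k
    unfolding F_def G_def by measurable
  have FG' [measurable]: "F k \<in> borel_measurable M" "G k \<in> borel_measurable M" for k
    using measurable_N_random_time[of "\<lambda>_. real k * h"] measurable_choose_integral[of "\<lambda>_. real k * h" j] h
    by (simp_all add: F_def[abs_def] G_def[abs_def])
  have sK: "real K * h \<le> real (Suc K) * h" "0 \<le> real K * h"
    using h by (auto intro: mult_right_mono)
  obtain d where d: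
    "(\<integral>\<^sup>+\<omega>. indicator A \<omega> * F (Suc K) \<omega> \<partial>M) = (\<integral>\<^sup>+\<omega>. indicator A \<omega> * F K \<omega> \<partial>M) + ennreal rate * d"
    "(\<integral>\<^sup>+\<omega>. indicator A \<omega> * G (Suc K) \<omega> \<partial>M) = (\<integral>\<^sup>+\<omega>. indicator A \<omega> * G K \<omega> \<partial>M) + d"
    unfolding F_def G_def A_def by (rule past_event_increments[OF sK(2,1) m])
  have IH: "(\<integral>\<^sup>+\<omega>. F (min (m \<omega>) K) \<omega> \<partial>M) = ennreal rate * (\<integral>\<^sup>+\<omega>. G (min (m \<omega>) K) \<omega> \<partial>M)"
    unfolding F_def G_def by (rule Suc)
  have "(\<integral>\<^sup>+\<omega>. F (min (m \<omega>) (Suc K)) \<omega> \<partial>M) = (\<integral>\<^sup>+\<omega>. F (min (m \<omega>) K) \<omega> \<partial>M) + ennreal rate * d"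
    using split[of "Suc K" F, OF _ FG(1) FG'(1)] split[of K F, OF _ FG(1) FG'(1)] d(1) by (simp add: ac_simps)
  also have "\<dots> = ennreal rate * ((\<integral>\<^sup>+\<omega>. G (min (m \<omega>) K) \<omega> \<partial>M) + d)"
    by (simp add: IH distrib_left)
  also have "(\<integral>\<^sup>+\<omega>. G (min (m \<omega>) K) \<omega> \<partial>M) + d = (\<integral>\<^sup>+\<omega>. G (min (m \<omega>) (Suc K)) \<omega> \<partial>M)"
    using split[of "Suc K" G, OF _ FG(2) FG'(2)] split[of K G, OF _ FG(2) FG'(2)] d(2) by (simp add: ac_simps)
  finally show ?case
    unfolding F_def G_def .
qed

text \<open>The grids divide \<open>[0, T]\<close> evenly, so rounding the stopping time up keeps it at most \<open>T\<close>. Hence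
  \<open>N T choose Suc j\<close> and \<open>(N T choose j) * T\<close> dominate the two sides, and both have finite
  expectation.\<close>

lemma optional_sampling_bounded:
  fixes r :: "'a \<Rightarrow> real"
  assumes T: "0 < T" and r: "\<And>\<omega>. 0 \<le> r \<omega>" "\<And>\<omega>. r \<omega> \<le> T"
    and adapted: "\<And>t. 0 \<le> t \<Longrightarrow> {\<omega>\<in>space M. t < r \<omega>} \<in> sets (natural_filtration M N (ennreal t))"
  shows "(\<integral>\<^sup>+\<omega>. of_nat (N (r \<omega>) \<omega> choose Suc j) \<partial>M) = ennreal rate * (\<integral>\<^sup>+\<omega>. choose_integral j (r \<omega>) \<omega> \<partial>M)"
proof -
  define h where "h n = T / real (Suc n)" for n
  define m where "m n \<omega> = grid_index (h n) (r \<omega>)" for n \<omega>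
  define x where "x n \<omega> = real (m n \<omega>) * h n" for n \<omega>
  have h: "0 < h n" for n
    using T by (simp add: h_def)
  have m_le: "m n \<omega> \<le> Suc n" for n \<omega>
  proof -
    have "\<not> Suc n < m n \<omega>"
      using r(2)[of \<omega>] unfolding m_def less_grid_index_iff[OF h] by (simp add: h_def not_less del: of_nat_Suc)
    then show ?thesis by simp
  qed
  have x_bounds: "r \<omega> \<le> x n \<omega>" "0 \<le> x n \<omega>" "x n \<omega> \<le> T" for n \<omega>
  proof -
    show "r \<omega> \<le> x n \<omega>"
      unfolding x_def m_def by (rule grid_index_bounds(1)[OF h r(1)])
    then show "0 \<le> x n \<omega>"
      using r(1)[of \<omega>] by simp
    have "x n \<omega> \<le> real (Suc n) * h n"
      unfolding x_def using m_le[of n \<omega>] h[of n] by (intro mult_right_mono) (simp_all del: of_nat_Suc)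
    then show "x n \<omega> \<le> T"
      by (simp add: h_def del: of_nat_Suc)
  qed
  have x_lim: "(\<lambda>n. x n \<omega>) \<longlonglongrightarrow> r \<omega>" for \<omega>
    unfolding x_def m_def h_def by (rule grid_tendsto[OF T r(1)])
  have r_meas [measurable]: "r \<in> borel_measurable M"
  proof (rule borel_measurableI_greater)
    fix t
    show "{\<omega>\<in>space M. t < r \<omega>} \<in> sets M"
    proof (cases "0 \<le> t")
      case True
      then show ?thesis using adapted sets_natural_filtration_subset by blast
    next
      case False
      then have "t < r \<omega>" for \<omega> using r(1)[of \<omega>] by simp
      then show ?thesis by simp
    qed
  qed
  have x_meas: "x n \<in> borel_measurable M" for n
    unfolding x_def m_def by measurable
  have N_meas: "(\<lambda>\<omega>. N (y \<omega>) \<omega>) \<in> measurable M (count_space UNIV)"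
    if "y \<in> borel_measurable M" "\<And>\<omega>. 0 \<le> y \<omega>" for y
    using that by (rule measurable_N_random_time)
  have grid: "(\<integral>\<^sup>+\<omega>. of_nat (N (x n \<omega>) \<omega> choose Suc j) \<partial>M) = ennreal rate * (\<integral>\<^sup>+\<omega>. choose_integral j (x n \<omega>) \<omega> \<partial>M)" for n
  proof -
    have "{\<omega>\<in>space M. k < m n \<omega>} \<in> sets (natural_filtration M N (ennreal (real k * h n)))" for k
      unfolding m_def less_grid_index_iff[OF h] using h[of n] by (intro adapted) simp
    from optional_sampling_grid[OF less_imp_le[OF h] this, where K = "Suc n" and j = j]
    show ?thesis
      by (simp add: min_absorb1[OF m_le] x_def)
  qed
  have "(\<lambda>n. \<integral>\<^sup>+\<omega>. of_nat (N (x n \<omega>) \<omega> choose Suc j) \<partial>M) \<longlonglongrightarrow> (\<integral>\<^sup>+\<omega>. of_nat (N (r \<omega>) \<omega> choose Suc j) \<partial>M)"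
  proof (rule nn_integral_dominated_convergence)
    show "(\<lambda>\<omega>. of_nat (N (x n \<omega>) \<omega> choose Suc j) :: ennreal) \<in> borel_measurable M" for n
      using N_meas[OF x_meas[of n] x_bounds(2)] by measurable
    show "(\<lambda>\<omega>. of_nat (N (r \<omega>) \<omega> choose Suc j) :: ennreal) \<in> borel_measurable M"
      using N_meas[OF r_meas r(1)] by measurable
    show "(\<lambda>\<omega>. of_nat (N T \<omega> choose Suc j) :: ennreal) \<in> borel_measurable M"
      using measurable_N[OF less_imp_le[OF T]] by measurable
    show "AE \<omega> in M. (of_nat (N (x n \<omega>) \<omega> choose Suc j) :: ennreal) \<le> of_nat (N T \<omega> choose Suc j)" for n
      using x_bounds by (intro AE_I2 choose_mono_path)
    show "(\<integral>\<^sup>+\<omega>. of_nat (N T \<omega> choose Suc j) \<partial>M) < \<infinity>"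
      using T by (intro nn_integral_choose_finite) simp
    show "AE \<omega> in M. (\<lambda>n. of_nat (N (x n \<omega>) \<omega> choose Suc j) :: ennreal) \<longlonglongrightarrow> of_nat (N (r \<omega>) \<omega> choose Suc j)"
    proof (intro AE_I2 tendsto_eventually)
      fix \<omega> assume "\<omega> \<in> space M"
      from eventually_N_eq[OF this r(1) x_lim[of \<omega>] x_bounds(1)]
      show "eventually (\<lambda>n. (of_nat (N (x n \<omega>) \<omega> choose Suc j) :: ennreal) = of_nat (N (r \<omega>) \<omega> choose Suc j)) sequentially"
        by eventually_elim simp
    qed
  qed
  moreover have "(\<lambda>n. \<integral>\<^sup>+\<omega>. choose_integral j (x n \<omega>) \<omega> \<partial>M) \<longlonglongrightarrow> (\<integral>\<^sup>+\<omega>. choose_integral j (r \<omega>) \<omega> \<partial>M)"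
  proof (rule nn_integral_dominated_convergence)
    have N_T [measurable]: "N T \<in> measurable M (count_space UNIV)"
      using T by (intro measurable_N) simp
    show "(\<lambda>\<omega>. choose_integral j (x n \<omega>) \<omega>) \<in> borel_measurable M" for n
      by (rule measurable_choose_integral[OF x_meas])
    show "(\<lambda>\<omega>. choose_integral j (r \<omega>) \<omega>) \<in> borel_measurable M"
      by (rule measurable_choose_integral[OF r_meas])
    show "(\<lambda>\<omega>. of_nat (N T \<omega> choose j) * ennreal T) \<in> borel_measurable M"
      by measurable
    show "AE \<omega> in M. choose_integral j (x n \<omega>) \<omega> \<le> of_nat (N T \<omega> choose j) * ennreal T" for n
      by (intro AE_I2 order_trans[OF choose_integral_mono[OF x_bounds(3)] choose_integral_le]) (use T in simp_all)
    have "(\<integral>\<^sup>+\<omega>. of_nat (N T \<omega> choose j) * ennreal T \<partial>M) = (\<integral>\<^sup>+\<omega>. of_nat (N T \<omega> choose j) \<partial>M) * ennreal T"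
      by (rule nn_integral_multc) measurable
    also have "\<dots> < \<infinity>"
      using nn_integral_choose_finite[of T j] T by (simp add: ennreal_mult_less_top)
    finally show "(\<integral>\<^sup>+\<omega>. of_nat (N T \<omega> choose j) * ennreal T \<partial>M) < \<infinity>" .
    show "AE \<omega> in M. (\<lambda>n. choose_integral j (x n \<omega>) \<omega>) \<longlonglongrightarrow> choose_integral j (r \<omega>) \<omega>"
      by (intro AE_I2 choose_integral_tendsto[where T = T] x_lim x_bounds r)
  qed
  then have "(\<lambda>n. ennreal rate * (\<integral>\<^sup>+\<omega>. choose_integral j (x n \<omega>) \<omega> \<partial>M)) \<longlonglongrightarrow> ennreal rate * (\<integral>\<^sup>+\<omega>. choose_integral j (r \<omega>) \<omega> \<partial>M)"
    by (rule ennreal_tendsto_cmult[rotated]) simp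
  ultimately show ?thesis
    unfolding grid by (rule LIMSEQ_unique)
qed

text \<open>Truncation at a level reduces to the bounded case. The truncated times increase and agree with
  \<open>\<tau>\<close> from some level on wherever \<open>\<tau>\<close> is finite, so both integrands are monotone limits almost
  everywhere.\<close>

lemma optional_sampling_choose:
  fixes \<tau> :: "'a \<Rightarrow> ennreal"
  assumes \<tau>: "stopping_time (natural_filtration M N) \<tau>" and fin: "AE \<omega> in M. \<tau> \<omega> < \<infinity>"
  shows "(\<integral>\<^sup>+\<omega>. of_nat (count_at N \<tau> \<omega> choose Suc j) \<partial>M) =
    ennreal rate * (\<integral>\<^sup>+\<omega>. choose_integral j (enn2real (\<tau> \<omega>)) \<omega> \<partial>M)"
proof -
  \<comment> \<open>Levels start at \<open>1\<close> because the bounded case asks for a positive bound.\<close>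
  define r where "r n \<omega> = enn2real (min (\<tau> \<omega>) (ennreal (real (Suc n))))" for n \<omega>
  have r_min: "ennreal (r n \<omega>) = min (\<tau> \<omega>) (ennreal (real (Suc n)))" for n \<omega>
    unfolding r_def by (rule ennreal_enn2real) (simp add: min_less_iff_disj)
  have r_bounds: "0 \<le> r n \<omega>" "r n \<omega> \<le> real (Suc n)" for n \<omega>
  proof -
    show "0 \<le> r n \<omega>" by (simp add: r_def)
    have "ennreal (r n \<omega>) \<le> ennreal (real (Suc n))"
      unfolding r_min by simp
    then show "r n \<omega> \<le> real (Suc n)"
      by (subst (asm) ennreal_le_iff) simp_all
  qed
  have r_mono: "r n \<omega> \<le> r k \<omega>" if "n \<le> k" for n k \<omega>
  proof -
    have "ennreal (r n \<omega>) \<le> ennreal (r k \<omega>)"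
      unfolding r_min using that by (intro min.mono ennreal_leI) simp_all
    then show ?thesis
      by (subst (asm) ennreal_le_iff) (simp_all add: r_bounds)
  qed
  have r_eventually: "eventually (\<lambda>n. r n \<omega> = enn2real (\<tau> \<omega>)) sequentially" if "\<tau> \<omega> < \<infinity>" for \<omega>
  proof -
    have "eventually (\<lambda>n. enn2real (\<tau> \<omega>) \<le> real n) sequentially"
      by (rule eventually_compose_filterlim[OF eventually_ge_at_top filterlim_real_sequentially])
    then show ?thesis
    proof eventually_elim
      case (elim n)
      have "\<tau> \<omega> = ennreal (enn2real (\<tau> \<omega>))"
        using that by simp
      also have "\<dots> \<le> ennreal (real (Suc n))"
        using elim by (intro ennreal_leI) simp
      finally show ?case
        by (simp add: r_def min_absorb1)
    qed
  qed
  have adapted: "{\<omega>\<in>space M. t < r n \<omega>} \<in> sets (natural_filtration M N (ennreal t))" if "0 \<le> t" for t n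
  proof -
    have "t < r n \<omega> \<longleftrightarrow> ennreal t < min (\<tau> \<omega>) (ennreal (real (Suc n)))" for \<omega>
      unfolding r_min[symmetric] using that by (simp add: ennreal_less_iff)
    then show ?thesis
      using stopping_timeD2[OF stopping_time_min[OF \<tau> stopping_time_const], of "ennreal t" "ennreal (real (Suc n))"]
      by (simp add: pred_def)
  qed
  have r_meas: "r n \<in> borel_measurable M" for n
  proof -
    have [measurable]: "\<tau> \<in> borel_measurable M"
      by (rule measurable_stopping_time[OF \<tau> sets_natural_filtration_subset space_natural_filtration])
    show ?thesis unfolding r_def by measurable
  qed
  have "(\<integral>\<^sup>+\<omega>. of_nat (count_at N \<tau> \<omega> choose Suc j) \<partial>M) = (\<integral>\<^sup>+\<omega>. (SUP n. of_nat (N (r n \<omega>) \<omega> choose Suc j)) \<partial>M)"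
  proof (rule nn_integral_cong_AE, use fin AE_space in eventually_elim)
    case (elim \<omega>)
    have "eventually (\<lambda>n. (of_nat (N (r n \<omega>) \<omega> choose Suc j) :: ennreal) = of_nat (count_at N \<tau> \<omega> choose Suc j)) sequentially"
      using r_eventually[OF elim(1)] by eventually_elim (simp add: count_at_def)
    then show ?case
      using elim(2)
      by (intro SUP_eventually_constant[symmetric] incseq_SucI choose_mono_path r_bounds r_mono) simp_all
  qed
  also have "\<dots> = (SUP n. \<integral>\<^sup>+\<omega>. of_nat (N (r n \<omega>) \<omega> choose Suc j) \<partial>M)"
  proof (rule nn_integral_monotone_convergence_SUP_AE)
    show "AE \<omega> in M. (of_nat (N (r n \<omega>) \<omega> choose Suc j) :: ennreal) \<le> of_nat (N (r (Suc n) \<omega>) \<omega> choose Suc j)" for n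
      by (intro AE_I2 choose_mono_path r_bounds r_mono) simp_all
    show "(\<lambda>\<omega>. of_nat (N (r n \<omega>) \<omega> choose Suc j) :: ennreal) \<in> borel_measurable M" for n
      using measurable_N_random_time[OF r_meas[of n] r_bounds(1)] by measurable
  qed
  also have "\<dots> = (SUP n. ennreal rate * (\<integral>\<^sup>+\<omega>. choose_integral j (r n \<omega>) \<omega> \<partial>M))"
    by (intro SUP_cong refl optional_sampling_bounded[OF _ r_bounds adapted]) simp_all
  also have "\<dots> = ennreal rate * (SUP n. \<integral>\<^sup>+\<omega>. choose_integral j (r n \<omega>) \<omega> \<partial>M)"
    by (rule SUP_mult_left_ennreal[symmetric])
  also have "(SUP n. \<integral>\<^sup>+\<omega>. choose_integral j (r n \<omega>) \<omega> \<partial>M) = (\<integral>\<^sup>+\<omega>. (SUP n. choose_integral j (r n \<omega>) \<omega>) \<partial>M)"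
  proof (rule nn_integral_monotone_convergence_SUP_AE[symmetric])
    show "AE \<omega> in M. choose_integral j (r n \<omega>) \<omega> \<le> choose_integral j (r (Suc n) \<omega>) \<omega>" for n
      by (intro AE_I2 choose_integral_mono r_mono) simp
    show "(\<lambda>\<omega>. choose_integral j (r n \<omega>) \<omega>) \<in> borel_measurable M" for n
      by (rule measurable_choose_integral[OF r_meas])
  qed
  also have "\<dots> = (\<integral>\<^sup>+\<omega>. choose_integral j (enn2real (\<tau> \<omega>)) \<omega> \<partial>M)"
  proof (rule nn_integral_cong_AE, use fin in eventually_elim)
    case (elim \<omega>)
    have "eventually (\<lambda>n. choose_integral j (r n \<omega>) \<omega> = choose_integral j (enn2real (\<tau> \<omega>)) \<omega>) sequentially"
      using r_eventually[OF elim] by eventually_elim simp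
    then show ?case
      by (intro SUP_eventually_constant incseq_SucI choose_integral_mono r_mono) simp_all
  qed
  finally show ?thesis .
qed

lemma cumulative_wait_eq_choose_integral:
  assumes "\<tau> \<omega> < \<infinity>"
  shows "cumulative_wait N \<tau> \<omega> = choose_integral 1 (enn2real (\<tau> \<omega>)) \<omega>"
proof -
  have "ennreal u \<le> \<tau> \<omega> \<longleftrightarrow> u \<le> enn2real (\<tau> \<omega>)" if "0 \<le> u" for u
    using assms that by (cases "\<tau> \<omega>") auto
  then show ?thesis
    unfolding cumulative_wait_def choose_integral_def
    by (intro nn_integral_cong) (auto simp: indicator_def ennreal_of_nat_eq_real_of_nat)
qed

end

section \<open>Consolidation cycles\<close>

lemma square_minus_self_eq_choose: "real n ^ 2 - real n = 2 * real (n choose 2)"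
  by (induction n) (simp_all add: numeral_2_eq_2 algebra_simps)

theorem mainTheorem11:
  fixes M :: "'a measure" and N :: "real \<Rightarrow> 'a \<Rightarrow> nat" and rate :: real
    and \<tau> :: "'a \<Rightarrow> ennreal"
  assumes "poisson_process M N rate"
    and "stopping_time (natural_filtration M N) \<tau>"
    and "0 < (\<integral>\<^sup>+\<omega>. \<tau> \<omega> \<partial>M)"
    and "(\<integral>\<^sup>+\<omega>. \<tau> \<omega> \<partial>M) < \<infinity>"
  shows "(\<integral>\<^sup>+\<omega>. cumulative_wait N \<tau> \<omega> \<partial>M) =
      ennreal (1 / (2 * rate)) *
        (\<integral>\<^sup>+\<omega>. ennreal (real (count_at N \<tau> \<omega>) ^ 2 - real (count_at N \<tau> \<omega>)) \<partial>M)
    \<and> (\<integral>\<^sup>+\<omega>. \<tau> \<omega> \<partial>M) =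
      ennreal (1 / rate) * (\<integral>\<^sup>+\<omega>. ennreal (real (count_at N \<tau> \<omega>)) \<partial>M)
    \<and> average_order_delay M N rate \<tau> =
      ((\<integral>\<^sup>+\<omega>. ennreal (real (count_at N \<tau> \<omega>) ^ 2 - real (count_at N \<tau> \<omega>)) \<partial>M)
          / ennreal (2 * rate))
        / (\<integral>\<^sup>+\<omega>. ennreal (real (count_at N \<tau> \<omega>)) \<partial>M)"
proof -
  interpret poisson_process M N rate by fact
  have \<tau>_meas: "\<tau> \<in> borel_measurable M"
    by (rule measurable_stopping_time[OF assms(2) sets_natural_filtration_subset space_natural_filtration])
  have fin: "AE \<omega> in M. \<tau> \<omega> < \<infinity>"
    using nn_integral_PInf_AE[OF \<tau>_meas] assms(4) by (simp add: less_top)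
  let ?EW = "\<integral>\<^sup>+\<omega>. cumulative_wait N \<tau> \<omega> \<partial>M"
  let ?ET = "\<integral>\<^sup>+\<omega>. \<tau> \<omega> \<partial>M"
  let ?EN = "\<integral>\<^sup>+\<omega>. ennreal (real (count_at N \<tau> \<omega>)) \<partial>M"
  let ?EQ = "\<integral>\<^sup>+\<omega>. ennreal (real (count_at N \<tau> \<omega>) ^ 2 - real (count_at N \<tau> \<omega>)) \<partial>M"
  have "?EN = ennreal rate * (\<integral>\<^sup>+\<omega>. choose_integral 0 (enn2real (\<tau> \<omega>)) \<omega> \<partial>M)"
    using optional_sampling_choose[OF assms(2) fin, of 0] by (simp add: ennreal_of_nat_eq_real_of_nat)
  also have "(\<integral>\<^sup>+\<omega>. choose_integral 0 (enn2real (\<tau> \<omega>)) \<omega> \<partial>M) = ?ET"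
    using fin by (intro nn_integral_cong_AE, eventually_elim) (simp add: choose_integral_0_eq)
  finally have EN: "?EN = ennreal rate * ?ET" .
  have count_meas: "count_at N \<tau> \<in> measurable M (count_space UNIV)"
    unfolding count_at_def[abs_def] using \<tau>_meas
    by (intro measurable_N_random_time) auto
  have "?EQ = (\<integral>\<^sup>+\<omega>. 2 * of_nat (count_at N \<tau> \<omega> choose 2) \<partial>M)"
    by (intro nn_integral_cong)
      (simp add: square_minus_self_eq_choose ennreal_mult' ennreal_of_nat_eq_real_of_nat)
  also have "\<dots> = 2 * (\<integral>\<^sup>+\<omega>. of_nat (count_at N \<tau> \<omega> choose Suc 1) \<partial>M)"
    using count_meas by (subst nn_integral_cmult) (auto simp: numeral_2_eq_2)
  also have "\<dots> = 2 * (ennreal rate * (\<integral>\<^sup>+\<omega>. choose_integral 1 (enn2real (\<tau> \<omega>)) \<omega> \<partial>M))"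
    by (subst optional_sampling_choose[OF assms(2) fin]) (rule refl)
  also have "(\<integral>\<^sup>+\<omega>. choose_integral 1 (enn2real (\<tau> \<omega>)) \<omega> \<partial>M) = ?EW"
    using fin by (intro nn_integral_cong_AE, eventually_elim) (simp add: cumulative_wait_eq_choose_integral)
  finally have EQ: "?EQ = ennreal (2 * rate) * ?EW"
    using rate_pos by (simp add: ennreal_mult' mult.assoc)
  have cancel: "ennreal (1 / c) * (ennreal c * x) = x" if "0 < c" for c x
    using that by (simp add: mult.assoc[symmetric] ennreal_mult[symmetric])
  have W: "?EW = ennreal (1 / (2 * rate)) * ?EQ"
    unfolding EQ using rate_pos by (subst cancel) auto
  moreover have "?ET = ennreal (1 / rate) * ?EN"
    unfolding EN using rate_pos by (subst cancel) auto
  moreover have "average_order_delay M N rate \<tau> = ?EQ / ennreal (2 * rate) / ?EN"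
    unfolding average_order_delay_def EN[symmetric] W
    using rate_pos by (simp add: divide_ennreal_def inverse_ennreal mult.commute inverse_eq_divide)
  ultimately show ?thesis by blast
qed

end
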